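(* Let $B=(b_{ij})_{i,j=1}^n$ be any square matrix satisfying $$b_{ij}=0\qquad\text{unless}\qquad 0<|i-j|\le2.$$ Let $C=(c_{ij})_{i,j=1}^n$ be the sign matrix whose only relevant negative entries are on the first superdiagonal, $$c_{ij}=\begin{cases}-1,&j=i+1,\\ 1,&\text{otherwise}.\end{cases}$$ Then $$\operatorname{perm}B=\det(C\circ B),$$ where $\circ$ denotes the Hadamard product. Thus the full coordinate subspace with zero main diagonal and lower and upper semibandwidths two is convertible by a signing rule independent of the matrix entries.
   Context: $\operatorname{perm}$ denotes the permanent, and the Hadamard product is the entrywise product. "Convertible" means that the permanent of every matrix in the subspace equals the determinant of the matrix obtained by multiplying its entries by fixed signs. *)

theory Defs
  imports "Jordan_Normal_Form.Determinant"
begin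

text \<open>
  Matrix indices run over \<open>0..<n\<close>. The band condition \<open>0 < \<bar>i - j\<bar> \<le> 2\<close> and the superdiagonal
  condition \<open>j = i + 1\<close> are invariant under the shift from \<open>1..n\<close>. Entries lie in an arbitrary
  commutative ring, which covers every field.
\<close>

definition permanent :: "'a :: comm_ring_1 mat \<Rightarrow> 'a" where
  "permanent A = (if dim_row A = dim_col A
     then (\<Sum>p | p permutes {0..<dim_row A}. \<Prod>i = 0..<dim_row A. A $$ (i, p i))
     else 0)"

definition hadamard :: "'a :: times mat \<Rightarrow> 'a mat \<Rightarrow> 'a mat"  (infixl \<open>\<circ>\<^sub>H\<close> 70) where
  "A \<circ>\<^sub>H B = mat (dim_row B) (dim_col B) (\<lambda>ij. A $$ ij * B $$ ij)"

definition superdiagonal_signs :: "nat \<Rightarrow> 'a :: comm_ring_1 mat" where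
  "superdiagonal_signs n = mat n n (\<lambda>(i, j). if j = i + 1 then -1 else 1)"

text \<open>Positions off the main diagonal within lower and upper semibandwidth two. The subtraction is
  taken over the integers, since truncated subtraction on naturals would be wrong here.\<close>

definition hollow_band :: "(nat \<times> nat) set" where
  "hollow_band = {(i, j). 0 < \<bar>int i - int j\<bar> \<and> \<bar>int i - int j\<bar> \<le> 2}"

definition coordinate_subspace :: "nat \<Rightarrow> (nat \<times> nat) set \<Rightarrow> 'a :: comm_ring_1 mat set" where
  "coordinate_subspace n I =
     {A \<in> carrier_mat n n. \<forall>i<n. \<forall>j<n. (i, j) \<notin> I \<longrightarrow> A $$ (i, j) = 0}"

definition sign_matrix :: "nat \<Rightarrow> 'a :: comm_ring_1 mat \<Rightarrow> bool" where
  "sign_matrix n S \<longleftrightarrow> S \<in> carrier_mat n n \<and> (\<forall>i<n. \<forall>j<n. S $$ (i, j) \<in> {1, -1})"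

text \<open>One sign matrix has to work for all members of \<open>V\<close> at once.\<close>

definition convertible :: "nat \<Rightarrow> 'a :: comm_ring_1 mat set \<Rightarrow> bool" where
  "convertible n V \<longleftrightarrow>
     V \<subseteq> carrier_mat n n \<and> (\<exists>S. sign_matrix n S \<and> (\<forall>A\<in>V. permanent A = det (S \<circ>\<^sub>H A)))"

end

(* A permutation p without fixed points that moves every index by at most two has exactly p i - i
   inversions (i, j) with left end i if i < p i, and none if p i < i. Hence p has as many
   inversions modulo two as there are indices with p i = i + 1, so its sign is cancelled by the
   signs on the first superdiagonal, and the Leibniz expansions of the permanent of B and of the
   determinant of the signed matrix agree term by term. *)
theory Submission
  imports Defs
begin

definition inversions_at :: "nat \<Rightarrow> (nat \<Rightarrow> nat) \<Rightarrow> nat \<Rightarrow> nat set" where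
  "inversions_at n p i = {j. i < j \<and> j < n \<and> p j < p i}"

text \<open>Grouping inversions by their left end turns their number into a sum over the indices,
  which is the form that the band condition controls.\<close>

definition inversions :: "nat \<Rightarrow> (nat \<Rightarrow> nat) \<Rightarrow> (nat \<times> nat) set" where
  "inversions n p = (SIGMA i:{0..<n}. inversions_at n p i)"

lemma in_inversions: "(i, j) \<in> inversions n p \<longleftrightarrow> i < j \<and> j < n \<and> p j < p i"
  by (auto simp: inversions_def inversions_at_def)

lemma finite_inversions_at: "finite (inversions_at n p i)"
  by (rule finite_subset[of _ "{0..<n}"]) (auto simp: inversions_at_def)

lemma finite_inversions: "finite (inversions n p)"
  by (auto simp: inversions_def finite_inversions_at)

lemma card_inversions: "card (inversions n p) = (\<Sum>i = 0..<n. card (inversions_at n p i))"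
  by (simp add: inversions_def finite_inversions_at)

text \<open>Let S be the set of earlier indices with smaller values. The values below p i are taken
  at S and at the right ends of inversions starting at i; the positions below i are S and the left
  ends of inversions ending at i. Eliminating the size of S between these two counts gives the
  identity.\<close>

lemma card_inversions_at:
  assumes p: "p permutes {0..<n}" and i: "i < n"
  shows "i + card (inversions_at n p i) = p i + card {j. j < i \<and> p i < p j}"
proof -
  define S where "S = {j. j < i \<and> p j < p i}"
  have inj: "inj p" using p by (rule permutes_inj)
  have less: "p j < n \<longleftrightarrow> j < n" for j using permutes_in_image[OF p, of j] by simp
  have "p ` {j. j < n \<and> p j < p i} = {0..<p i}"
  proof (intro equalityI subsetI)
    fix y assume y: "y \<in> {0..<p i}"
    obtain x where x: "y = p x" using permutes_surj[OF p] by (metis surjD)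
    have "p i < n" using less i by simp
    then have "x < n" using y x less[of x] by simp
    then show "y \<in> p ` {j. j < n \<and> p j < p i}" using x y by simp
  qed auto
  then have "card {j. j < n \<and> p j < p i} = p i"
    by (metis card_image card_atLeastLessThan diff_zero inj inj_on_subset subset_UNIV)
  moreover have "{j. j < n \<and> p j < p i} = S \<union> inversions_at n p i"
    using i by (auto simp: S_def inversions_at_def) (metis linorder_neqE_nat less_irrefl)
  moreover have "card (S \<union> inversions_at n p i) = card S + card (inversions_at n p i)"
    by (rule card_Un_disjoint) (auto simp: S_def finite_inversions_at, auto simp: inversions_at_def)
  ultimately have "p i = card S + card (inversions_at n p i)" by argo
  moreover have "{0..<i} = S \<union> {j. j < i \<and> p i < p j}"
    using inj by (auto simp: S_def inj_def) (metis linorder_neqE_nat less_irrefl)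
  moreover have "card (S \<union> {j. j < i \<and> p i < p j}) = card S + card {j. j < i \<and> p i < p j}"
    by (rule card_Un_disjoint) (auto simp: S_def)
  moreover have "card {0..<i} = i" by simp
  ultimately have "i = card S + card {j. j < i \<and> p i < p j}" by argo
  with \<open>p i = card S + card (inversions_at n p i)\<close> show ?thesis by linarith
qed

text \<open>Both correction terms in \<open>card_inversions_at\<close> vanish, which leaves p i =
  i.\<close>

lemma permutes_without_inversions:
  assumes p: "p permutes {0..<n}" and "inversions n p = {}"
  shows "p = id"
proof
  fix i
  show "p i = id i"
  proof (cases "i < n")
    case True
    have "j \<notin> inversions_at n p i" "\<not> (j < i \<and> p i < p j)" for j
      using assms(2) True in_inversions[of i j n p] in_inversions[of j i n p]
      by (auto simp: inversions_at_def)
    then have "inversions_at n p i = {}" "{j. j < i \<and> p i < p j} = {}" by blast+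
    with card_inversions_at[OF p True] show ?thesis by (simp only: card.empty add_0_right id_apply)
  next
    case False
    then show ?thesis using permutes_not_in[OF p] by simp
  qed
qed

text \<open>Without a descent between neighbours, p would be nondecreasing below n and could have no
  inversion at all.\<close>

lemma adjacent_inversion:
  assumes "(i, j) \<in> inversions n p"
  obtains k where "(k, Suc k) \<in> inversions n p"
proof (rule ccontr)
  assume *: "\<not> thesis"
  have "p k \<le> p (Suc k)" if "Suc k < n" for k
    using * that \<open>\<And>k. (k, Suc k) \<in> inversions n p \<Longrightarrow> thesis\<close>
    by (meson in_inversions lessI not_le_imp_less)
  moreover have "i \<le> j" "j < n" "p j < p i" using assms by (auto simp: in_inversions)
  moreover have "p i \<le> p (i + d)" if "i + d < n" "\<And>k. Suc k < n \<Longrightarrow> p k \<le> p (Suc k)" for d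
    using that by (induction d) (auto intro: order_trans)
  ultimately show False by (metis le_add_diff_inverse not_le)
qed

text \<open>Relabelling positions by the transposition keeps the order of every pair except (k, Suc
  k). It therefore matches the inversions of the composite with those of p other than (k, Suc k),
  and that pair itself is no inversion of the composite.\<close>

lemma card_inversions_adjacent_transpose:
  assumes p: "p permutes {0..<n}" and k: "(k, Suc k) \<in> inversions n p"
  shows "card (inversions n p) = Suc (card (inversions n (p \<circ> transpose k (Suc k))))"
proof -
  let ?t = "transpose k (Suc k)"
  let ?T = "map_prod ?t ?t"
  let ?I = "inversions n (p \<circ> ?t)"
  have kn: "Suc k < n" "p (Suc k) < p k" using k by (auto simp: in_inversions)
  have fwd: "?T x \<in> inversions n p - {(k, Suc k)}" if "x \<in> ?I" for x
    using that kn
    by (cases x) (auto simp: in_inversions transpose_def split: if_splits)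
  have bwd: "?T x \<in> ?I" if "x \<in> inversions n p - {(k, Suc k)}" for x
    using that kn
    by (cases x) (auto simp: in_inversions transpose_def split: if_splits)
  have "?T (?T x) = x" for x by (cases x) simp
  then have "bij_betw ?T ?I (inversions n p - {(k, Suc k)})"
    using fwd bwd by (intro bij_betwI[where g = ?T]) auto
  then have "card ?I = card (inversions n p - {(k, Suc k)})" by (rule bij_betw_same_card)
  then show ?thesis using card_Suc_Diff1[OF finite_inversions k] by simp
qed

text \<open>This is bubble sort: each swap of an adjacent inversion removes exactly one inversion
  and flips the sign, until the identity is reached.\<close>

lemma sign_eq_inversions:
  assumes "p permutes {0..<n}"
  shows "sign p = (-1) ^ card (inversions n p)"
  using assms
proof (induction "card (inversions n p)" arbitrary: p)
  case 0
  then have "p = id" using permutes_without_inversions finite_inversions by (metis card_0_eq)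
  then show ?case using 0 by simp
next
  case (Suc m)
  from Suc.hyps(2) obtain x where "x \<in> inversions n p"
    by (metis card.empty ex_in_conv nat.distinct(1))
  then obtain k where k: "(k, Suc k) \<in> inversions n p"
    using adjacent_inversion by (metis surj_pair)
  let ?t = "transpose k (Suc k)"
  have "Suc k < n" using k by (simp add: in_inversions)
  then have t: "?t permutes {0..<n}" by (intro permutes_swap_id) auto
  have card: "card (inversions n p) = Suc (card (inversions n (p \<circ> ?t)))"
    by (rule card_inversions_adjacent_transpose[OF Suc.prems k])
  have "sign (p \<circ> ?t) = (-1) ^ card (inversions n (p \<circ> ?t))"
    using Suc.hyps card by (intro Suc.hyps(1) permutes_compose[OF t Suc.prems]) simp
  moreover have "sign (p \<circ> ?t) = - sign p"
    using Suc.prems t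
    by (subst sign_compose) (auto simp: sign_swap_id intro: permutes_imp_permutation[of "{0..<n}"])
  ultimately show ?case using card by simp
qed

lemma sign_hollow_band:
  assumes p: "p permutes {0..<n}" and band: "\<And>i. i < n \<Longrightarrow> (i, p i) \<in> hollow_band"
  shows "sign p = (\<Prod>i = 0..<n. if p i = i + 1 then -1 else 1)"
proof -
  have near: "p i \<noteq> i" "p i \<le> i + 2" "i \<le> p i + 2" if "i < n" for i
    using band[OF that] by (auto simp: hollow_band_def)
  \<comment> \<open>truncated subtraction: zero if p i < i\<close>
  have "card (inversions_at n p i) = p i - i" if i: "i < n" for i
  proof (cases "i < p i")
    case True
    \<comment> \<open>For j < i the band gives p j \<le> j + 2 \<le> i + 1 \<le> p i, so no
      inversion ends at i.\<close>
    have "\<not> (j < i \<and> p i < p j)" for j using near(2)[of j] i True by fastforce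
    then have "card {j. j < i \<and> p i < p j} = 0" by simp
    then show ?thesis using card_inversions_at[OF p i] by linarith
  next
    case False
    \<comment> \<open>Here p i < i, since i is not fixed. For j > i the band gives p j \<ge> j - 2
      \<ge> i - 1 \<ge> p i.\<close>
    have "j \<notin> inversions_at n p i" for j
      using near(3)[of j] near(1)[OF i] False by (auto simp: inversions_at_def)
    then have "inversions_at n p i = {}" by blast
    then show ?thesis using False by simp
  qed
  then have "sign p = (-1) ^ (\<Sum>i = 0..<n. p i - i)"
    by (simp add: sign_eq_inversions[OF p] card_inversions)
  also have "\<dots> = (\<Prod>i = 0..<n. (-1) ^ (p i - i))" by (simp add: power_sum)
  also have "\<dots> = (\<Prod>i = 0..<n. if p i = i + 1 then -1 else 1)"
  proof (rule prod.cong)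
    fix i assume "i \<in> {0..<n}"
    \<comment> \<open>A jump of two contributes an even number of inversions, so only jumps of
      exactly one affect the sign.\<close>
    then have "p i - i = 0 \<and> p i \<noteq> i + 1 \<or> p i - i = 1 \<and> p i = i + 1 \<or> p i - i = 2 \<and> p i \<noteq> i + 1"
      using near(2)[of i] by auto
    then show "(-1 :: int) ^ (p i - i) = (if p i = i + 1 then -1 else 1)" by auto
  qed simp
  finally show ?thesis .
qed

lemma permanent_hollow_band:
  fixes B :: "'a :: comm_ring_1 mat"
  assumes B: "B \<in> coordinate_subspace n hollow_band"
  shows "permanent B = det (superdiagonal_signs n \<circ>\<^sub>H B)"
proof -
  have car: "B \<in> carrier_mat n n"
    and zero: "\<And>i j. i < n \<Longrightarrow> j < n \<Longrightarrow> (i, j) \<notin> hollow_band \<Longrightarrow> B $$ (i, j) = 0"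
    using B by (auto simp: coordinate_subspace_def)
  let ?C = "superdiagonal_signs n \<circ>\<^sub>H B"
  have carC: "?C \<in> carrier_mat n n" using car by (simp add: hadamard_def)
  have "(\<Prod>i = 0..<n. B $$ (i, p i)) = signof p * (\<Prod>i = 0..<n. ?C $$ (i, p i))"
    if p: "p permutes {0..<n}" for p
  proof -
    have less: "p i < n" if "i < n" for i using permutes_in_image[OF p, of i] that by simp
    \<comment> \<open>The signs are kept as integers so that their product can be compared with
      \<open>sign p\<close> before being cast into the ring.\<close>
    define e :: "nat \<Rightarrow> int" where "e i = (if p i = i + 1 then -1 else 1)" for i
    have "(\<Prod>i = 0..<n. ?C $$ (i, p i)) = (\<Prod>i = 0..<n. of_int (e i) * B $$ (i, p i))"
      using car less by (intro prod.cong) (auto simp: hadamard_def superdiagonal_signs_def e_def)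
    also have "\<dots> = of_int (\<Prod>i = 0..<n. e i) * (\<Prod>i = 0..<n. B $$ (i, p i))"
      by (simp add: prod.distrib)
    finally have C: "(\<Prod>i = 0..<n. ?C $$ (i, p i)) =
      of_int (\<Prod>i = 0..<n. e i) * (\<Prod>i = 0..<n. B $$ (i, p i))" .
    show ?thesis
    proof (cases "\<forall>i<n. (i, p i) \<in> hollow_band")
      case True
      then have "(\<Prod>i = 0..<n. e i) = sign p" by (simp add: sign_hollow_band[OF p] e_def)
      \<comment> \<open>The sign from the Leibniz formula meets the equal product of the entry
        signs, and the two cancel.\<close>
      moreover have "(signof p :: 'a) * signof p = 1"
        by (metis of_int_1 of_int_mult sign_idempotent)
      ultimately show ?thesis by (simp add: C flip: mult.assoc del: of_int_prod)
    next
      case False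
      \<comment> \<open>A permutation that leaves the band picks a zero entry of B. Both terms
        vanish, so its sign is irrelevant.\<close>
      then have "(\<Prod>i = 0..<n. B $$ (i, p i)) = 0"
        using zero less by (intro prod_zero) (auto intro!: bexI)
      then show ?thesis by (simp add: C)
    qed
  qed
  then show ?thesis using car by (auto simp: permanent_def det_def'[OF carC] intro!: sum.cong)
qed

theorem proposition4p1:
  fixes n :: nat
  shows "(\<forall>B :: 'a :: comm_ring_1 mat. B \<in> carrier_mat n n \<longrightarrow>
            (\<forall>i<n. \<forall>j<n. \<not> (0 < \<bar>int i - int j\<bar> \<and> \<bar>int i - int j\<bar> \<le> 2) \<longrightarrow> B $$ (i, j) = 0) \<longrightarrow>
            permanent B = det (superdiagonal_signs n \<circ>\<^sub>H B))
       \<and> convertible n (coordinate_subspace n hollow_band :: 'a mat set)"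
proof (intro conjI allI impI)
  fix B :: "'a mat"
  assume "B \<in> carrier_mat n n"
    and "\<forall>i<n. \<forall>j<n. \<not> (0 < \<bar>int i - int j\<bar> \<and> \<bar>int i - int j\<bar> \<le> 2) \<longrightarrow> B $$ (i, j) = 0"
  then show "permanent B = det (superdiagonal_signs n \<circ>\<^sub>H B)"
    by (intro permanent_hollow_band) (simp add: coordinate_subspace_def hollow_band_def)
next
  have "sign_matrix n (superdiagonal_signs n :: 'a mat)"
    by (auto simp: sign_matrix_def superdiagonal_signs_def)
  moreover have "coordinate_subspace n hollow_band \<subseteq> (carrier_mat n n :: 'a mat set)"
    by (auto simp: coordinate_subspace_def)
  ultimately show "convertible n (coordinate_subspace n hollow_band :: 'a mat set)"
    unfolding convertible_def using permanent_hollow_band by blast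
qed

end
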